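(* Let $n$ be the maximum set size and let ${\cal U}$ be a universe of size $u>n^4$. Any adaptive AMQ storing a set ${\cal S}\subseteq{\cal U}$ of size $n$ requires $\Omega(\min\{n\log n,\ n\log\log u\})$ bits of space (counting both local and remote state) with high probability in order to maintain any constant sustained false-positive rate $\epsilon<1$.
   Context: An approximate membership query data structure (AMQ) with private infinite random string $\rho$, private local state $L$ and private remote state $R$ consists of deterministic functions: $\mathrm{Build}(n,\epsilon,\rho)\to(L,R)$; $\mathrm{Lookup}(L,x,\rho)\to(L',b)$ with $b\in\{\textsc{Present},\textsc{Absent}\}$, which does not access $R$ and must return $\textsc{Present}$ whenever $x\in{\cal S}$ (no false negatives), where ${\cal S}$ is the set of items inserted more recently than deleted; $\mathrm{Insert}((L,R),x,\rho)$ for $|{\cal S}|<n$, $x\notin{\cal S}$, and $\mathrm{Delete}((L,R),x,\rho)$ for $x\in{\cal S}$, each returning a new state; and $\mathrm{Update}((L,R),x,\rho)\to(L',R')$, defined for $x\notin{\cal S}$ on which Lookup returned Present (feedback on a false positive). An element $x\notin{\cal S}$ is a false positive of the state if Lookup on $x$ returns Present. In the adaptivity game, the AMQ is built with $\mathrm{Build}(n,\epsilon,\rho)$ for uniformly random $\rho$ and ${\cal S}=\emptyset$; an adversary ${\cal A}$ (given $n,\epsilon$ but not $\rho$ or the state) interacts with an oracle supporting lookups, inserts (only if $|{\cal S}|<n$ and $x\notin{\cal S}$) and deletes (only if $x\in{\cal S}$); on each lookup the oracle runs Lookup and, if the answer is Present and $x\notin{\cal S}$, runs Update. Finally ${\cal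 A}$ outputs $x'$, and wins if Lookup on $x'$ returns Present and $x'\notin{\cal S}$. The AMQ has sustained false-positive rate $\epsilon$ if for all $n$ and all adversaries the winning probability is at most $\epsilon$; it is adaptive if it has sustained false-positive rate at most some constant $\epsilon<1$.
   Formalization: "With high probability" is rendered as probability at least 1 − ε − n^(−d) for a constant d > 0, since an AMQ that with probability up to ε answers Present to everything with empty state, and is otherwise exact, makes the literal claim false. *)

theory Defs
  imports "HOL-Probability.Probability"
begin

type_synonym bits = "bool list"
type_synonym state = "bits \<times> bits"  \<comment> \<open>local state, remote state\<close>
type_synonym random_string = "nat \<Rightarrow> bool"

datatype answer = Present | Absent

text \<open>
  The items are natural numbers; the universe is a finite set \<open>U\<close> of naturals, passed separately.
  Since \<open>Lookup\<close> takes and returns only the local state, it has no access to the remote state.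
\<close>

record amq =
  Build :: "nat \<Rightarrow> real \<Rightarrow> random_string \<Rightarrow> state"
  Lookup :: "bits \<Rightarrow> nat \<Rightarrow> random_string \<Rightarrow> bits \<times> answer"
  Insert :: "state \<Rightarrow> nat \<Rightarrow> random_string \<Rightarrow> state"
  Delete :: "state \<Rightarrow> nat \<Rightarrow> random_string \<Rightarrow> state"
  Update :: "state \<Rightarrow> nat \<Rightarrow> random_string \<Rightarrow> state"

definition random_strings :: "random_string measure" where
  "random_strings = Pi\<^sub>M UNIV (\<lambda>_. measure_pmf (bernoulli_pmf (1/2)))"

text \<open>
  A configuration is the stored set together with the state of the data structure.
  Operations that the oracle does not support (an item outside the universe, an insertion of a
  stored item or into a full set, a deletion of an item not stored) leave it unchanged; they give
  an adversary nothing, as the stored set is known to it.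
\<close>

type_synonym config = "nat set \<times> state"

definition do_lookup ::
    "amq \<Rightarrow> nat set \<Rightarrow> random_string \<Rightarrow> nat \<Rightarrow> config \<Rightarrow> answer \<times> config" where
  "do_lookup A U \<rho> x = (\<lambda>(S, L, R).
     if x \<in> U then
       let (L', b) = Lookup A L x \<rho>
       in (b, S, if b = Present \<and> x \<notin> S then Update A (L', R) x \<rho> else (L', R))
     else (Absent, S, L, R))"

definition do_insert ::
    "amq \<Rightarrow> nat set \<Rightarrow> nat \<Rightarrow> random_string \<Rightarrow> nat \<Rightarrow> config \<Rightarrow> config" where
  "do_insert A U n \<rho> x = (\<lambda>(S, st).
     if x \<in> U \<and> x \<notin> S \<and> card S < n then (insert x S, Insert A st x \<rho>) else (S, st))"

definition do_delete :: "amq \<Rightarrow> random_string \<Rightarrow> nat \<Rightarrow> config \<Rightarrow> config" where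
  "do_delete A \<rho> x = (\<lambda>(S, st).
     if x \<in> S then (S - {x}, Delete A st x \<rho>) else (S, st))"

text \<open>
  A deterministic adaptive strategy is a decision tree branching on the answers to its lookups.
  A randomized adversary is a probability mass function on such trees.
\<close>

datatype strategy =
    Ask nat "answer \<Rightarrow> strategy"
  | Add nat strategy
  | Remove nat strategy
  | Output nat

type_synonym adversary = "strategy pmf"

text \<open>All configurations passed through, in order, and the final output of the strategy.\<close>

primrec play ::
    "amq \<Rightarrow> nat set \<Rightarrow> nat \<Rightarrow> random_string \<Rightarrow> strategy \<Rightarrow> config \<Rightarrow> config list \<times> nat" where
  "play A U n \<rho> (Ask x k) = (\<lambda>C.
     let (b, C') = do_lookup A U \<rho> x C; (Cs, y) = play A U n \<rho> (k b) C' in (C # Cs, y))"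
| "play A U n \<rho> (Add x t) = (\<lambda>C.
     let (Cs, y) = play A U n \<rho> t (do_insert A U n \<rho> x C) in (C # Cs, y))"
| "play A U n \<rho> (Remove x t) = (\<lambda>C.
     let (Cs, y) = play A U n \<rho> t (do_delete A \<rho> x C) in (C # Cs, y))"
| "play A U n \<rho> (Output y) = (\<lambda>C. ([C], y))"

definition game ::
    "amq \<Rightarrow> nat set \<Rightarrow> nat \<Rightarrow> real \<Rightarrow> random_string \<Rightarrow> strategy \<Rightarrow> config list \<times> nat" where
  "game A U n \<epsilon> \<rho> t = play A U n \<rho> t ({}, Build A n \<epsilon> \<rho>)"

text \<open>
  Measurability in the random string is what makes the probabilities below meaningful. It holds for
  every function that inspects only finitely many bits of the string before returning.
\<close>

definition amq_measurable :: "amq \<Rightarrow> bool" where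
  "amq_measurable A \<longleftrightarrow>
     (\<forall>n \<epsilon>. Build A n \<epsilon> \<in> measurable random_strings (count_space UNIV)) \<and>
     (\<forall>L x. Lookup A L x \<in> measurable random_strings (count_space UNIV)) \<and>
     (\<forall>st x. Insert A st x \<in> measurable random_strings (count_space UNIV)) \<and>
     (\<forall>st x. Delete A st x \<in> measurable random_strings (count_space UNIV)) \<and>
     (\<forall>st x. Update A st x \<in> measurable random_strings (count_space UNIV))"

definition no_false_negatives :: "amq \<Rightarrow> nat set \<Rightarrow> nat \<Rightarrow> real \<Rightarrow> bool" where
  "no_false_negatives A U n \<epsilon> \<longleftrightarrow>
     (\<forall>\<rho> t. \<forall>(S, L, R) \<in> set (fst (game A U n \<epsilon> \<rho> t)). \<forall>x\<in>S. snd (Lookup A L x \<rho>) = Present)"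

definition is_amq :: "amq \<Rightarrow> nat set \<Rightarrow> nat \<Rightarrow> real \<Rightarrow> bool" where
  "is_amq A U n \<epsilon> \<longleftrightarrow> amq_measurable A \<and> no_false_negatives A U n \<epsilon>"

text \<open>Probability over the coins of the adversary and the random string.\<close>

definition game_prob :: "adversary \<Rightarrow> (random_string \<Rightarrow> strategy \<Rightarrow> bool) \<Rightarrow> real" where
  "game_prob \<A> E = measure_pmf.expectation \<A> (\<lambda>t. \<P>(\<rho> in random_strings. E \<rho> t))"

definition wins :: "amq \<Rightarrow> nat set \<Rightarrow> nat \<Rightarrow> real \<Rightarrow> random_string \<Rightarrow> strategy \<Rightarrow> bool" where
  "wins A U n \<epsilon> \<rho> t \<longleftrightarrow>
     (let (Cs, x) = game A U n \<epsilon> \<rho> t; (S, L, R) = last Cs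
      in x \<in> U \<and> x \<notin> S \<and> snd (Lookup A L x \<rho>) = Present)"

text \<open>The rate at a given capacity \<open>n\<close>; an AMQ has sustained rate \<open>\<epsilon>\<close> if this holds for all \<open>n\<close>.\<close>

definition sustained_fpr :: "amq \<Rightarrow> nat set \<Rightarrow> nat \<Rightarrow> real \<Rightarrow> bool" where
  "sustained_fpr A U n \<epsilon> \<longleftrightarrow> (\<forall>\<A>. game_prob \<A> (wins A U n \<epsilon>) \<le> \<epsilon>)"

definition needs_space ::
    "amq \<Rightarrow> nat set \<Rightarrow> nat \<Rightarrow> real \<Rightarrow> real \<Rightarrow> random_string \<Rightarrow> strategy \<Rightarrow> bool" where
  "needs_space A U n \<epsilon> s \<rho> t \<longleftrightarrow>
     (\<exists>(S, L, R) \<in> set (fst (game A U n \<epsilon> \<rho> t)).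
        card S = n \<and> real (length L + length R) \<ge> s)"

text \<open>
  Here "with high probability" has to mean \<open>1 - \<epsilon> - n powr - d\<close> for a constant \<open>d > 0\<close>: an AMQ that
  always answers \<^term>\<open>Present\<close>, with empty state, on a set of random strings of probability at
  most \<open>\<epsilon>\<close>, and is an exact dictionary otherwise, has sustained false-positive rate \<open>\<epsilon>\<close>, so the
  loss of \<open>\<epsilon>\<close> is unavoidable.
\<close>

end

theory Submission
  imports Defs "HOL-Real_Asymp.Real_Asymp"
begin

text \<open>
  Store a random set of \<open>n\<close> items, draw \<open>q = n\<^sup>2\<close> further random items, query all of them, then
  those that turned out to be false positives, then the false positives among these, and so on for
  \<open>k\<close> rounds. An adversary that stops at a random query of a random round, outputting the item
  instead of querying it, wins with the average ratio of the sizes of consecutive rounds. If some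
  item survives all rounds, the product of these ratios is at least \<open>1 / q\<close>, so their average is at
  least \<open>1 - ln q / k\<close>.

  It remains to see that few bits force a survivor. Given the queries, the state after the
  insertions determines all later states, and every stored item is present in all of them. A union
  bound over the states after the insertions shows that the items present in all visited states
  usually have density at least \<open>n powr - (1/4)\<close>. On the other hand, once the start states of the
  rounds are fixed, all rounds can be run in parallel on fresh random items, each of which survives
  with probability at least that density; a union bound over the start states finishes the argument.
\<close>

section \<open>Rounds of queries\<close>

text \<open>\<open>P s x\<close> is to be read as: state \<open>s\<close> answers Present on
  \<open>x\<close>; \<open>f s x\<close> is the state after the query. Keeping both abstract leaves
  a plain automaton, to which the counting applies for each fixed random string.\<close>

primrec survivors :: "('s \<Rightarrow> 'a \<Rightarrow> bool) \<Rightarrow> ('s \<Rightarrow> 'a \<Rightarrow> 's) \<Rightarrow> 's \<Rightarrow> 'a list \<Rightarrow> 'a list" where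
  "survivors P f s [] = []"
| "survivors P f s (x # xs) =
     (if P s x then x # survivors P f (f s x) xs else survivors P f (f s x) xs)"

primrec visited :: "('s \<Rightarrow> 'a \<Rightarrow> 's) \<Rightarrow> 's \<Rightarrow> 'a list \<Rightarrow> 's set" where
  "visited f s [] = {s}"
| "visited f s (x # xs) = insert s (visited f (f s x) xs)"

primrec stage :: "('s \<Rightarrow> 'a \<Rightarrow> bool) \<Rightarrow> ('s \<Rightarrow> 'a \<Rightarrow> 's) \<Rightarrow> nat \<Rightarrow> 's \<Rightarrow> 'a list \<Rightarrow> 's \<times> 'a list" where
  "stage P f 0 s xs = (s, xs)"
| "stage P f (Suc i) s xs = stage P f i (foldl f s xs) (survivors P f s xs)"

primrec starts :: "('s \<Rightarrow> 'a \<Rightarrow> bool) \<Rightarrow> ('s \<Rightarrow> 'a \<Rightarrow> 's) \<Rightarrow> nat \<Rightarrow> 's \<Rightarrow> 'a list \<Rightarrow> 's list" where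
  "starts P f 0 s xs = []"
| "starts P f (Suc i) s xs = s # starts P f i (foldl f s xs) (survivors P f s xs)"

text \<open>The start states of the rounds are an arbitrary list here, decoupled from the queries,
  so that they can be fixed before the queries are drawn.\<close>

primrec thread_survivors ::
    "('s \<Rightarrow> 'a \<Rightarrow> bool) \<Rightarrow> ('s \<Rightarrow> 'a \<Rightarrow> 's) \<Rightarrow> 's list \<Rightarrow> 'a list \<Rightarrow> 'a list" where
  "thread_survivors P f [] xs = xs"
| "thread_survivors P f (s # ss) xs = thread_survivors P f ss (survivors P f s xs)"

primrec thread_visited ::
    "('s \<Rightarrow> 'a \<Rightarrow> bool) \<Rightarrow> ('s \<Rightarrow> 'a \<Rightarrow> 's) \<Rightarrow> 's list \<Rightarrow> 'a list \<Rightarrow> 's set" where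
  "thread_visited P f [] xs = {}"
| "thread_visited P f (s # ss) xs = visited f s xs \<union> thread_visited P f ss (survivors P f s xs)"

text \<open>
  Running the rounds in parallel, one query at a time: a query reaches a thread only if it survived
  the preceding ones.
\<close>

primrec thread_step ::
    "('s \<Rightarrow> 'a \<Rightarrow> bool) \<Rightarrow> ('s \<Rightarrow> 'a \<Rightarrow> 's) \<Rightarrow> 's list \<Rightarrow> 'a \<Rightarrow> 's list" where
  "thread_step P f [] x = []"
| "thread_step P f (s # ss) x = f s x # (if P s x then thread_step P f ss x else ss)"

text \<open>Stepwise form of the density condition: it concerns only the current states of the
  threads when an item arrives, so that one fresh item at a time can be counted.\<close>

primrec dense ::
    "('s \<Rightarrow> 'a \<Rightarrow> bool) \<Rightarrow> ('s \<Rightarrow> 'a \<Rightarrow> 's) \<Rightarrow> 'a set \<Rightarrow> real \<Rightarrow> 's list \<Rightarrow> 'a list \<Rightarrow> bool" where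
  "dense P f U b ss [] \<longleftrightarrow> True"
| "dense P f U b ss (x # xs) \<longleftrightarrow>
     b \<le> card {x \<in> U. \<forall>s\<in>set ss. P s x} \<and> dense P f U b (thread_step P f ss x) xs"

section \<open>Sequential rounds and parallel threads\<close>

lemma survivors_subset: "set (survivors P f s xs) \<subseteq> set xs"
  by (induction xs arbitrary: s) auto

lemma length_survivors_le: "length (survivors P f s xs) \<le> length xs"
  by (induction xs arbitrary: s) (auto intro: le_SucI)

lemma start_visited [simp]: "s \<in> visited f s xs"
  by (cases xs) auto

lemma stage_subset: "set (snd (stage P f i s xs)) \<subseteq> set xs"
  by (induction i arbitrary: s xs) (use survivors_subset in fastforce)+

text \<open>\<open>stage\<close> peels off the first round; this peels off the last, which is what
  comparing the sizes of consecutive rounds requires.\<close>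

lemma stage_Suc:
  "stage P f (Suc i) s xs =
    (let (s', ys) = stage P f i s xs in (foldl f s' ys, survivors P f s' ys))"
  by (induction i arbitrary: s xs) auto

text \<open>Transfers counting results on threads with prescribed start states to the rounds as they
  are actually played.\<close>

lemma thread_survivors_starts:
  "thread_survivors P f (starts P f i s xs) xs = snd (stage P f i s xs)"
  by (induction i arbitrary: s xs) auto

lemma length_starts [simp]: "length (starts P f i s xs) = i"
  by (induction i arbitrary: s xs) auto

lemma threads_subset_visited: "set ss \<subseteq> thread_visited P f ss xs"
  by (induction ss arbitrary: xs) fastforce+

lemma thread_visited_step:
  "thread_visited P f (thread_step P f ss x) xs \<subseteq> thread_visited P f ss (x # xs)"
  by (induction ss arbitrary: xs) fastforce+

text \<open>Exchanges the loops, from rounds outside and items inside to items outside. No thread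
  has moved before the first item, so only the start states decide on it; once rejected, it leaves
  the later threads unmoved, as in \<open>thread_step\<close>.\<close>

lemma thread_survivors_Cons:
  "thread_survivors P f ss (x # xs) =
    (if \<forall>s\<in>set ss. P s x then [x] else []) @ thread_survivors P f (thread_step P f ss x) xs"
  by (induction ss arbitrary: xs) auto

text \<open>The states of the threads at the arrival of any item are all among the visited
  states.\<close>

lemma dense_if_visited:
  fixes b :: real
  assumes "finite U" "b \<le> card {x \<in> U. \<forall>s\<in>thread_visited P f ss xs. P s x}"
  shows "dense P f U b ss xs"
  using assms(2)
proof (induction xs arbitrary: ss)
  case (Cons y xs)
  have "card {x \<in> U. \<forall>s\<in>thread_visited P f ss (y # xs). P s x}
      \<le> card {x \<in> U. \<forall>s\<in>set ss. P s x}"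
    using threads_subset_visited[of ss P f "y # xs"] assms(1) by (intro card_mono) auto
  moreover have "card {x \<in> U. \<forall>s\<in>thread_visited P f ss (y # xs). P s x}
      \<le> card {x \<in> U. \<forall>s\<in>thread_visited P f (thread_step P f ss y) xs. P s x}"
    using thread_visited_step[of P f ss y xs] assms(1) by (intro card_mono) auto
  ultimately show ?case
    using Cons by auto
qed auto

text \<open>Gives a uniformly random query of a round its success probability: the ratio of the size
  of the next round to that of this one.\<close>

lemma card_present_survivors:
  "card {j. j < length xs \<and> P (foldl f s (take j xs)) (xs ! j)} = length (survivors P f s xs)"
proof (induction xs arbitrary: s)
  case (Cons x xs)
  let ?A = "{j. j < length xs \<and> P (foldl f (f s x) (take j xs)) (xs ! j)}"
  have "{j. j < length (x # xs) \<and> P (foldl f s (take j (x # xs))) ((x # xs) ! j)} =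
      (if P s x then insert 0 (Suc ` ?A) else Suc ` ?A)" (is "?L = ?R")
  proof (intro set_eqI)
    show "j \<in> ?L \<longleftrightarrow> j \<in> ?R" for j by (cases j) auto
  qed
  then show ?case
    using Cons[of "f s x"] by (simp add: card_image card_insert_if)
qed auto

text \<open>From \<open>ln x \<le> x - 1\<close>, each \<open>1 - a (Suc i) / a i\<close> is at most
  \<open>ln (a i) - ln (a (Suc i))\<close>. These differences telescope, and \<open>ln (a k)\<close>
  is nonnegative.\<close>

lemma sum_ratio_ge:
  fixes a :: "nat \<Rightarrow> real"
  assumes "\<And>i. i \<le> k \<Longrightarrow> a i \<ge> 1"
  shows "(\<Sum>i<k. a (Suc i) / a i) \<ge> k - ln (a 0)"
proof -
  have "1 - a (Suc i) / a i \<le> ln (a i) - ln (a (Suc i))" if "i < k" for i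
  proof -
    have "a i \<ge> 1" "a (Suc i) \<ge> 1" using assms that by auto
    then show ?thesis
      using ln_le_minus_one[of "a (Suc i) / a i"] by (simp add: ln_div)
  qed
  then have "(\<Sum>i<k. 1 - a (Suc i) / a i) \<le> (\<Sum>i<k. ln (a i) - ln (a (Suc i)))"
    by (intro sum_mono) auto
  also have "\<dots> = ln (a 0) - ln (a k)"
    by (rule sum_lessThan_telescope')
  also have "\<dots> \<le> ln (a 0)"
    using assms[of k] by simp
  finally show ?thesis
    by (simp add: sum_subtractf)
qed

section \<open>Counting lists\<close>

text \<open>Lists rather than sets: drawing with replacement makes the coordinates independent, and
  probabilities become counts divided by powers of \<open>card U\<close>.\<close>

definition lists_of :: "'a set \<Rightarrow> nat \<Rightarrow> 'a list set" where
  "lists_of U m = {xs. set xs \<subseteq> U \<and> length xs = m}"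

lemma finite_lists_of [simp]: "finite U \<Longrightarrow> finite (lists_of U m)"
  by (simp add: lists_of_def finite_lists_length_eq)

lemma card_lists_of: "finite U \<Longrightarrow> card (lists_of U m) = card U ^ m"
  by (simp add: lists_of_def card_lists_length_eq)

lemma lists_of_0 [simp]: "lists_of U 0 = {[]}"
  by (auto simp: lists_of_def)

lemma sum_lists_of_Suc:
  "(\<Sum>xs\<in>lists_of U (Suc m). g xs) = (\<Sum>x\<in>U. \<Sum>xs\<in>lists_of U m. g (x # xs))"
proof -
  have "lists_of U (Suc m) = (\<lambda>(x, xs). x # xs) ` (U \<times> lists_of U m)"
    by (auto simp: lists_of_def length_Suc_conv image_def)
  moreover have "inj_on (\<lambda>(x, xs). x # xs) (U \<times> lists_of U m)"
    by (auto simp: inj_on_def)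
  ultimately show ?thesis
    by (simp add: sum.reindex sum.cartesian_product case_prod_unfold)
qed

lemma sum_of_bool_card: "finite X \<Longrightarrow> (\<Sum>x\<in>X. of_bool (Q x)) = real (card {x \<in> X. Q x})"
  by (simp add: Int_def)

text \<open>Union bound over the positions. Multiplying by \<open>card U\<close> instead of dividing
  lets the induction run for empty \<open>U\<close> as well.\<close>

lemma count_meeting:
  assumes "finite U" "finite Z"
  shows "real (card U) * (\<Sum>xs\<in>lists_of U m. of_bool (set xs \<inter> Z \<noteq> {})) \<le> m * card Z * real (card U) ^ m"
proof (induction m)
  case (Suc m)
  let ?u = "real (card U)"
  let ?c = "\<Sum>xs\<in>lists_of U m. of_bool (set xs \<inter> Z \<noteq> {}) :: real"
  have "(\<Sum>xs\<in>lists_of U (Suc m). of_bool (set xs \<inter> Z \<noteq> {}) :: real)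
      \<le> (\<Sum>x\<in>U. \<Sum>xs\<in>lists_of U m. of_bool (x \<in> Z) + of_bool (set xs \<inter> Z \<noteq> {}))"
    unfolding sum_lists_of_Suc by (intro sum_mono) auto
  also have "\<dots> = card (U \<inter> Z) * ?u ^ m + ?u * ?c"
    using assms by (simp add: sum.distrib card_lists_of sum_of_bool_card Int_def
        flip: sum_distrib_left sum_distrib_right)
  also have "\<dots> \<le> card Z * ?u ^ m + ?u * ?c"
    using assms by (intro add_right_mono mult_right_mono) (auto intro: card_mono)
  finally have "?u * (\<Sum>xs\<in>lists_of U (Suc m). of_bool (set xs \<inter> Z \<noteq> {}))
      \<le> ?u * (card Z * ?u ^ m + ?u * ?c)"
    by (intro mult_left_mono) auto
  also have "\<dots> \<le> ?u * (card Z * ?u ^ m + m * card Z * ?u ^ m)"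
    using Suc by (intro mult_left_mono add_left_mono) auto
  also have "\<dots> = Suc m * card Z * ?u ^ Suc m"
    by (simp add: algebra_simps)
  finally show ?case .
qed auto

text \<open>Birthday bound: the head of the list collides with a tail of length \<open>m\<close> for
  at most \<open>m\<close> of its values.\<close>

lemma count_not_distinct:
  assumes "finite U"
  shows "real (card U) * (\<Sum>xs\<in>lists_of U m. of_bool (\<not> distinct xs)) \<le> real m ^ 2 * real (card U) ^ m"
proof (induction m)
  case (Suc m)
  let ?u = "real (card U)"
  let ?c = "\<Sum>xs\<in>lists_of U m. of_bool (\<not> distinct xs) :: real"
  have inner: "(\<Sum>x\<in>U. of_bool (x \<in> set xs) :: real) \<le> m" if "xs \<in> lists_of U m" for xs
  proof -
    have "card {x \<in> U. x \<in> set xs} \<le> card (set xs)"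
      by (intro card_mono) auto
    then show ?thesis
      using assms that card_length[of xs] by (simp add: sum_of_bool_card lists_of_def Int_def)
  qed
  have "(\<Sum>xs\<in>lists_of U (Suc m). of_bool (\<not> distinct xs) :: real)
      \<le> (\<Sum>x\<in>U. \<Sum>xs\<in>lists_of U m. of_bool (x \<in> set xs) + of_bool (\<not> distinct xs))"
    unfolding sum_lists_of_Suc by (intro sum_mono) auto
  also have "\<dots> = (\<Sum>xs\<in>lists_of U m. \<Sum>x\<in>U. of_bool (x \<in> set xs)) + ?u * ?c"
    unfolding sum.distrib by (subst sum.swap) simp
  also have "\<dots> \<le> (\<Sum>xs\<in>lists_of U m. real m) + ?u * ?c"
    using inner by (intro add_right_mono sum_mono) auto
  also have "\<dots> = ?u ^ m * m + ?u * ?c"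
    using assms by (simp add: card_lists_of)
  finally have "?u * (\<Sum>xs\<in>lists_of U (Suc m). of_bool (\<not> distinct xs))
      \<le> ?u * (?u ^ m * m + ?u * ?c)"
    by (intro mult_left_mono) auto
  also have "\<dots> \<le> ?u * (?u ^ m * m + real m ^ 2 * ?u ^ m)"
    using Suc by (intro mult_left_mono add_left_mono) auto
  also have "\<dots> = (real m + real m ^ 2) * ?u ^ Suc m"
    by (simp add: algebra_simps)
  also have "\<dots> \<le> real (Suc m) ^ 2 * ?u ^ Suc m"
    by (intro mult_right_mono) (auto simp: power2_eq_square algebra_simps)
  finally show ?case .
qed auto

text \<open>With the thread states fixed, the next item fails to survive only if some current state
  rejects it, hence for at most \<open>card U - b\<close> choices. Whatever the item is, the
  induction hypothesis covers the states to which the threads move, so the factors multiply.\<close>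

lemma count_dense_no_survivors:
  fixes b :: real
  assumes "finite U" "0 \<le> b" "b \<le> card U"
  shows "(\<Sum>xs\<in>lists_of U q. of_bool (dense P f U b ss xs \<and> thread_survivors P f ss xs = []))
    \<le> (card U - b) ^ q"
proof (induction q arbitrary: ss)
  case (Suc q)
  let ?bad = "\<lambda>ss xs. dense P f U b ss xs \<and> thread_survivors P f ss xs = []"
  let ?K = "{x \<in> U. \<forall>s\<in>set ss. P s x}"
  show ?case
  proof (cases "b \<le> card ?K")
    case True
    have "(\<Sum>xs\<in>lists_of U (Suc q). of_bool (?bad ss xs) :: real)
        \<le> (\<Sum>x\<in>U. of_bool (x \<notin> ?K) *
              (\<Sum>xs\<in>lists_of U q. of_bool (?bad (thread_step P f ss x) xs)))"
      unfolding sum_lists_of_Suc sum_distrib_left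
      by (intro sum_mono) (auto simp: thread_survivors_Cons)
    also have "\<dots> \<le> (\<Sum>x\<in>U. of_bool (x \<notin> ?K) * (card U - b) ^ q)"
      using Suc by (intro sum_mono mult_left_mono) auto
    also have "\<dots> = card (U - ?K) * (card U - b) ^ q"
      using assms(1) by (simp only: sum_of_bool_card set_diff_eq flip: sum_distrib_right)
    also have "card (U - ?K) = real (card U) - card ?K"
      using assms(1) by (subst card_Diff_subset) (auto intro!: of_nat_diff card_mono)
    also have "\<dots> * (card U - b) ^ q \<le> (card U - b) * (card U - b) ^ q"
      using True assms by (intro mult_right_mono) auto
    finally show ?thesis by simp
  next
    case False
    then have "(\<Sum>xs\<in>lists_of U (Suc q). of_bool (?bad ss xs) :: real) = 0"
      unfolding sum_lists_of_Suc by simp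
    then show ?thesis using assms by simp
  qed
qed (simp del: sum_of_bool_eq)

text \<open>Residues mod \<open>m\<close> are equidistributed below a multiple of \<open>m\<close>.
  With a factorial as \<open>N\<close>, one range of random numbers yields uniform positions in
  lists of every length that occurs.\<close>

lemma count_mod:
  assumes "m dvd N" "m > 0"
  shows "real m * (\<Sum>j<N. of_bool (Q (j mod m))) = N * card {j. j < m \<and> Q j}"
proof -
  obtain d where d: "N = d * m"
    using assms(1) by (metis dvdE mult.commute)
  have "(\<Sum>j<N. of_bool (Q (j mod m)) :: real) =
      (\<Sum>i<d. \<Sum>j\<in>{i * m..<i * m + m}. of_bool (Q (j mod m)))"
    unfolding d by (rule sum.nat_group[symmetric])
  also have "\<dots> = (\<Sum>i<d. \<Sum>j<m. of_bool (Q j))"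
  proof (rule sum.cong[OF refl])
    fix i
    have "(\<Sum>j\<in>{0 + i * m..<m + i * m}. of_bool (Q (j mod m)) :: real) = (\<Sum>j<m. of_bool (Q j))"
      unfolding sum.shift_bounds_nat_ivl by (auto simp: atLeast0LessThan intro!: sum.cong)
    then show "(\<Sum>j\<in>{i * m..<i * m + m}. of_bool (Q (j mod m)) :: real) = (\<Sum>j<m. of_bool (Q j))"
      by (simp add: add.commute)
  qed
  also have "\<dots> = d * card {j. j < m \<and> Q j}"
    by (simp add: sum_of_bool_card del: sum_of_bool_eq)
  finally show ?thesis
    unfolding d by simp
qed

lemma sum_of_bool_Bex_le:
  assumes "finite B"
  shows "(\<Sum>x\<in>X. of_bool (\<exists>y\<in>B. Q x y) :: real) \<le> (\<Sum>y\<in>B. \<Sum>x\<in>X. of_bool (Q x y))"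
proof -
  have "of_bool (\<exists>y\<in>B. Q x y) \<le> (\<Sum>y\<in>B. of_bool (Q x y) :: real)" for x
  proof (cases "\<exists>y\<in>B. Q x y")
    case True
    then obtain y where y: "y \<in> B" "Q x y" by auto
    then have "of_bool (Q x y) \<le> (\<Sum>y\<in>B. of_bool (Q x y) :: real)"
      using assms by (intro member_le_sum) auto
    then show ?thesis using y True by simp
  qed (simp add: sum_nonneg)
  then have "(\<Sum>x\<in>X. of_bool (\<exists>y\<in>B. Q x y) :: real) \<le> (\<Sum>x\<in>X. \<Sum>y\<in>B. of_bool (Q x y))"
    by (intro sum_mono)
  then show ?thesis
    by (subst sum.swap)
qed

section \<open>Random samples on which the attack may fail\<close>

definition shared ::
    "('s \<Rightarrow> 'a \<Rightarrow> bool) \<Rightarrow> ('s \<Rightarrow> 'a \<Rightarrow> 's) \<Rightarrow> 'a set \<Rightarrow> nat \<Rightarrow> 's \<Rightarrow> 'a list \<Rightarrow> 'a set" where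
  "shared P f U k s xs = {x \<in> U. \<forall>s'\<in>thread_visited P f (starts P f k s xs) xs. P s' x}"

text \<open>\<open>B\<close> will contain all states of few bits. The last alternative ranges over
  all tuples because the actual start states depend on \<open>xs\<close>.\<close>

definition bad_sample ::
    "('s \<Rightarrow> 'a \<Rightarrow> bool) \<Rightarrow> ('s \<Rightarrow> 'a \<Rightarrow> 's) \<Rightarrow> 'a set \<Rightarrow> 's set \<Rightarrow> real \<Rightarrow> nat \<Rightarrow> 'a list \<Rightarrow> 'a list \<Rightarrow> bool"
  where
  "bad_sample P f U B b k ys xs \<longleftrightarrow>
     \<not> distinct ys \<or> set xs \<inter> set ys \<noteq> {} \<or>
     (\<exists>s\<in>B. set ys \<subseteq> shared P f U k s xs \<and> real (card (shared P f U k s xs)) < b) \<or>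
     (\<exists>ss\<in>lists_of B k. dense P f U b ss xs \<and> thread_survivors P f ss xs = [])"

text \<open>
  The state \<open>s\<close> reached after storing \<open>ys\<close> determines, for given \<open>xs\<close>, the whole trajectory; hence
  only \<open>card B\<close> shared sets have to be considered. Independence of \<open>xs\<close> from the start states of
  the rounds costs a union bound over all tuples of \<open>k\<close> states.
\<close>

lemma count_bad_sample:
  fixes b :: real
  assumes U: "finite U" "0 \<le> b" "b \<le> card U" "card U > 0" and B: "finite B"
  shows "(\<Sum>ys\<in>lists_of U n. \<Sum>xs\<in>lists_of U q. of_bool (bad_sample P f U B b k ys xs))
    \<le> (real n ^ 2 + real q * real n) / card U * real (card U) ^ n * real (card U) ^ q
      + card B * b ^ n * real (card U) ^ q
      + real (card B) ^ k * (card U - b) ^ q * real (card U) ^ n"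
proof -
  let ?u = "real (card U)"
  let ?Y = "lists_of U n" and ?X = "lists_of U q"
  let ?I = "shared P f U k"
  have "(\<Sum>ys\<in>?Y. \<Sum>xs\<in>?X. of_bool (\<not> distinct ys) :: real)
      = ?u ^ q * (\<Sum>ys\<in>?Y. of_bool (\<not> distinct ys))"
    using U by (simp add: card_lists_of sum_distrib_left)
  also have "\<dots> \<le> ?u ^ q * (real n ^ 2 * ?u ^ n / ?u)"
    using count_not_distinct[of U n] U
    by (intro mult_left_mono) (simp_all add: pos_le_divide_eq mult.commute)
  finally have 1: "(\<Sum>ys\<in>?Y. \<Sum>xs\<in>?X. of_bool (\<not> distinct ys) :: real)
      \<le> ?u ^ q * (real n ^ 2 * ?u ^ n / ?u)" .
  have "(\<Sum>ys\<in>?Y. \<Sum>xs\<in>?X. of_bool (set xs \<inter> set ys \<noteq> {}) :: real)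
      \<le> (\<Sum>ys\<in>?Y. real q * n * ?u ^ q / ?u)"
  proof (intro sum_mono)
    fix ys assume "ys \<in> ?Y"
    then have "card (set ys) \<le> n"
      using card_length[of ys] by (simp add: lists_of_def)
    then have "real (q * card (set ys)) * ?u ^ q \<le> real q * n * ?u ^ q"
      by (intro mult_right_mono) (auto intro: mult_left_mono)
    with count_meeting[of U "set ys" q] U
    have "?u * (\<Sum>xs\<in>?X. of_bool (set xs \<inter> set ys \<noteq> {})) \<le> real q * n * ?u ^ q"
      by (meson List.finite_set order_trans)
    then show "(\<Sum>xs\<in>?X. of_bool (set xs \<inter> set ys \<noteq> {}) :: real) \<le> real q * n * ?u ^ q / ?u"
      using U by (simp add: pos_le_divide_eq mult.commute del: sum_of_bool_eq)
  qed
  also have "\<dots> = ?u ^ n * (real q * n * ?u ^ q / ?u)"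
    using U by (simp add: card_lists_of)
  finally have 2: "(\<Sum>ys\<in>?Y. \<Sum>xs\<in>?X. of_bool (set xs \<inter> set ys \<noteq> {}) :: real)
      \<le> ?u ^ n * (real q * n * ?u ^ q / ?u)" .
  \<comment> \<open>The sums are swapped because the shared set depends on \<open>xs\<close> and
    \<open>s\<close> but not on \<open>ys\<close>; if it has fewer than \<open>b\<close> elements,
    at most \<open>b ^ n\<close> lists \<open>ys\<close> lie in it.\<close>
  have "(\<Sum>ys\<in>?Y. \<Sum>xs\<in>?X. of_bool (\<exists>s\<in>B. set ys \<subseteq> ?I s xs \<and> real (card (?I s xs)) < b) :: real)
      = (\<Sum>xs\<in>?X. \<Sum>ys\<in>?Y. of_bool (\<exists>s\<in>B. set ys \<subseteq> ?I s xs \<and> real (card (?I s xs)) < b))"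
    by (rule sum.swap)
  also have "\<dots> \<le> (\<Sum>xs\<in>?X. card B * b ^ n)"
  proof (intro sum_mono)
    fix xs
    have "(\<Sum>ys\<in>?Y. of_bool (set ys \<subseteq> ?I s xs \<and> real (card (?I s xs)) < b) :: real) \<le> b ^ n" for s
    proof (cases "card (?I s xs) < b")
      case True
      have sub: "?I s xs \<subseteq> U"
        by (auto simp: shared_def)
      then have "{ys \<in> ?Y. set ys \<subseteq> ?I s xs} = lists_of (?I s xs) n"
        by (auto simp: lists_of_def)
      moreover have "card (lists_of (?I s xs) n) = card (?I s xs) ^ n"
        using sub U by (intro card_lists_of) (rule finite_subset)
      ultimately have "(\<Sum>ys\<in>?Y. of_bool (set ys \<subseteq> ?I s xs) :: real) = real (card (?I s xs)) ^ n"
        using U by (subst sum_of_bool_card) auto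
      also have "\<dots> \<le> b ^ n"
        using True by (intro power_mono) auto
      finally show ?thesis using True by simp
    qed (use U in simp)
    then have "(\<Sum>s\<in>B. \<Sum>ys\<in>?Y. of_bool (set ys \<subseteq> ?I s xs \<and> real (card (?I s xs)) < b) :: real)
        \<le> card B * b ^ n"
      by (rule sum_bounded_above)
    then show "(\<Sum>ys\<in>?Y. of_bool (\<exists>s\<in>B. set ys \<subseteq> ?I s xs \<and> real (card (?I s xs)) < b) :: real)
        \<le> card B * b ^ n"
      by (rule order_trans[OF sum_of_bool_Bex_le[OF B]])
  qed
  also have "\<dots> = card B * b ^ n * ?u ^ q"
    using U by (simp add: card_lists_of)
  finally have 3: "(\<Sum>ys\<in>?Y. \<Sum>xs\<in>?X. of_bool (\<exists>s\<in>B. set ys \<subseteq> ?I s xs \<and> real (card (?I s xs)) < b) :: real)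
      \<le> card B * b ^ n * ?u ^ q" .
  \<comment> \<open>Each of the \<open>card B ^ k\<close> tuples is fixed before \<open>xs\<close>
    is drawn, so \<open>count_dense_no_survivors\<close> applies to it; the resulting bound is the
    same for every \<open>ys\<close>.\<close>
  let ?dead = "\<lambda>ss xs. dense P f U b ss xs \<and> thread_survivors P f ss xs = []"
  have "(\<Sum>xs\<in>?X. of_bool (\<exists>ss\<in>lists_of B k. ?dead ss xs) :: real)
      \<le> (\<Sum>ss\<in>lists_of B k. \<Sum>xs\<in>?X. of_bool (?dead ss xs))"
    using B by (intro sum_of_bool_Bex_le) auto
  also have "\<dots> \<le> card (lists_of B k) * (?u - b) ^ q"
    by (intro sum_bounded_above count_dense_no_survivors U)
  also have "\<dots> = real (card B) ^ k * (?u - b) ^ q"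
    using B by (simp add: card_lists_of)
  finally have "(\<Sum>ys\<in>?Y. \<Sum>xs\<in>?X. of_bool (\<exists>ss\<in>lists_of B k. ?dead ss xs) :: real)
      \<le> card ?Y * (real (card B) ^ k * (?u - b) ^ q)"
    by (intro sum_bounded_above)
  also have "\<dots> = real (card B) ^ k * (?u - b) ^ q * ?u ^ n"
    using U by (simp add: card_lists_of)
  finally have 4: "(\<Sum>ys\<in>?Y. \<Sum>xs\<in>?X. of_bool (\<exists>ss\<in>lists_of B k. ?dead ss xs) :: real)
      \<le> real (card B) ^ k * (?u - b) ^ q * ?u ^ n" .
  have "(\<Sum>ys\<in>?Y. \<Sum>xs\<in>?X. of_bool (bad_sample P f U B b k ys xs))
      \<le> (\<Sum>ys\<in>?Y. \<Sum>xs\<in>?X. of_bool (\<not> distinct ys) + of_bool (set xs \<inter> set ys \<noteq> {})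
          + of_bool (\<exists>s\<in>B. set ys \<subseteq> ?I s xs \<and> real (card (?I s xs)) < b)
          + of_bool (\<exists>ss\<in>lists_of B k. ?dead ss xs) :: real)"
    unfolding bad_sample_def by (intro sum_mono) (simp add: of_bool_def)
  also have "\<dots> \<le> ?u ^ q * (real n ^ 2 * ?u ^ n / ?u) + ?u ^ n * (real q * n * ?u ^ q / ?u)
      + card B * b ^ n * ?u ^ q + real (card B) ^ k * (?u - b) ^ q * ?u ^ n"
    unfolding sum.distrib by (intro add_mono 1 2 3 4)
  also have "?u ^ q * (real n ^ 2 * ?u ^ n / ?u) + ?u ^ n * (real q * n * ?u ^ q / ?u)
      = (real n ^ 2 + real q * real n) / ?u * ?u ^ n * ?u ^ q"
    by (simp add: add_divide_distrib algebra_simps)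
  finally show ?thesis .
qed

section \<open>The attack\<close>

definition present :: "amq \<Rightarrow> random_string \<Rightarrow> state \<Rightarrow> nat \<Rightarrow> bool" where
  "present A \<rho> st x \<longleftrightarrow> snd (Lookup A (fst st) x \<rho>) = Present"

text \<open>Effect of looking up an item outside the stored set: every Present is then a false
  positive and triggers \<open>Update\<close>, while an Absent lookup may still change the local
  state.\<close>

definition respond :: "amq \<Rightarrow> random_string \<Rightarrow> state \<Rightarrow> nat \<Rightarrow> state" where
  "respond A \<rho> st x = (let (L', b) = Lookup A (fst st) x \<rho>
     in if b = Present then Update A (L', snd st) x \<rho> else (L', snd st))"

text \<open>The continuation \<open>K\<close> receives the items that were answered Present, in
  order; this is how the decision tree depends on all answers of a round at once.\<close>

primrec ask_each :: "nat list \<Rightarrow> (nat list \<Rightarrow> strategy) \<Rightarrow> strategy" where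
  "ask_each [] K = K []"
| "ask_each (x # xs) K =
     Ask x (\<lambda>b. ask_each xs (\<lambda>ys. K (if b = Present then x # ys else ys)))"

primrec rounds :: "nat \<Rightarrow> nat list \<Rightarrow> (nat list \<Rightarrow> strategy) \<Rightarrow> strategy" where
  "rounds 0 xs K = K xs"
| "rounds (Suc i) xs K = ask_each xs (\<lambda>ys. rounds i ys K)"

text \<open>The final output is arbitrary: this strategy serves only to drive the structure through
  its configurations.\<close>

definition full_attack :: "nat \<Rightarrow> nat list \<Rightarrow> nat list \<Rightarrow> strategy" where
  "full_attack k ys xs = foldr Add ys (rounds k xs (\<lambda>_. Output 0))"

text \<open>Stops before one query of round \<open>i\<close> and outputs its item instead. The size
  of the round is known only during play, so the position is a residue of \<open>r\<close>. If
  \<open>zs\<close> is empty, \<open>r mod 0\<close> is \<open>r\<close> and the output is an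
  unspecified item.\<close>

definition probe :: "nat list \<Rightarrow> nat list \<Rightarrow> nat \<Rightarrow> nat \<Rightarrow> strategy" where
  "probe ys xs i r = foldr Add ys (rounds i xs (\<lambda>zs.
     ask_each (take (r mod length zs) zs) (\<lambda>_. Output (zs ! (r mod length zs)))))"

section \<open>Playing the attack\<close>

lemma play_nonempty [simp]: "fst (play A U n \<rho> t C) \<noteq> []"
  by (cases t) (auto simp: case_prod_unfold Let_def)

lemma start_in_play [simp]: "C \<in> set (fst (play A U n \<rho> t C))"
  by (cases t) (auto simp: case_prod_unfold Let_def)

lemma do_lookup_absent:
  assumes "x \<in> U" "x \<notin> S"
  shows "do_lookup A U \<rho> x (S, st) =
    (if present A \<rho> st x then Present else Absent, S, respond A \<rho> st x)"
  using assms answer.exhaust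
  by (auto simp: do_lookup_def present_def respond_def case_prod_unfold Let_def split: prod.splits)

text \<open>Translates play into the abstract automaton. Configurations are compared as sets because
  the state after the last query is also the first one of the continuation and lies in both parts of
  the union.\<close>

lemma play_ask_each:
  assumes "set xs \<subseteq> U" "set xs \<inter> S = {}"
  shows "set (fst (play A U n \<rho> (ask_each xs K) (S, st))) =
           Pair S ` visited (respond A \<rho>) st xs \<union>
           set (fst (play A U n \<rho> (K (survivors (present A \<rho>) (respond A \<rho>) st xs))
             (S, foldl (respond A \<rho>) st xs)))" (is ?A)
    and "last (fst (play A U n \<rho> (ask_each xs K) (S, st))) =
           last (fst (play A U n \<rho> (K (survivors (present A \<rho>) (respond A \<rho>) st xs))
             (S, foldl (respond A \<rho>) st xs)))" (is ?B)
    and "snd (play A U n \<rho> (ask_each xs K) (S, st)) =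
           snd (play A U n \<rho> (K (survivors (present A \<rho>) (respond A \<rho>) st xs))
             (S, foldl (respond A \<rho>) st xs))" (is ?C)
proof -
  have "?A \<and> ?B \<and> ?C"
    using assms
  proof (induction xs arbitrary: st K)
    case Nil
    then show ?case by (auto simp: insert_absorb)
  next
    case (Cons x xs)
    let ?K = "\<lambda>ys. K (if present A \<rho> st x then x # ys else ys)"
    have IH: "set (fst (play A U n \<rho> (ask_each xs ?K) (S, respond A \<rho> st x))) =
           Pair S ` visited (respond A \<rho>) (respond A \<rho> st x) xs \<union>
           set (fst (play A U n \<rho> (?K (survivors (present A \<rho>) (respond A \<rho>) (respond A \<rho> st x) xs))
             (S, foldl (respond A \<rho>) (respond A \<rho> st x) xs)))"
      "last (fst (play A U n \<rho> (ask_each xs ?K) (S, respond A \<rho> st x))) =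
           last (fst (play A U n \<rho> (?K (survivors (present A \<rho>) (respond A \<rho>) (respond A \<rho> st x) xs))
             (S, foldl (respond A \<rho>) (respond A \<rho> st x) xs)))"
      "snd (play A U n \<rho> (ask_each xs ?K) (S, respond A \<rho> st x)) =
           snd (play A U n \<rho> (?K (survivors (present A \<rho>) (respond A \<rho>) (respond A \<rho> st x) xs))
             (S, foldl (respond A \<rho>) (respond A \<rho> st x) xs))"
      using Cons.IH[of ?K "respond A \<rho> st x"] Cons.prems by auto
    have x: "x \<in> U" "x \<notin> S" using Cons.prems by auto
    show ?case
      using IH by (cases "present A \<rho> st x")
        (simp_all add: do_lookup_absent[OF x] case_prod_unfold Let_def)
  qed
  then show ?A ?B ?C by auto
qed

lemma play_rounds:
  fixes A :: amq and \<rho> :: random_string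
  assumes "set xs \<subseteq> U" "set xs \<inter> S = {}"
  defines "P \<equiv> present A \<rho>" and "f \<equiv> respond A \<rho>"
  shows "set (fst (play A U n \<rho> (rounds i xs K) (S, st))) =
           Pair S ` thread_visited P f (starts P f i st xs) xs \<union>
           set (fst (play A U n \<rho> (K (snd (stage P f i st xs))) (S, fst (stage P f i st xs))))" (is ?A)
    and "last (fst (play A U n \<rho> (rounds i xs K) (S, st))) =
           last (fst (play A U n \<rho> (K (snd (stage P f i st xs))) (S, fst (stage P f i st xs))))" (is ?B)
    and "snd (play A U n \<rho> (rounds i xs K) (S, st)) =
           snd (play A U n \<rho> (K (snd (stage P f i st xs))) (S, fst (stage P f i st xs)))" (is ?C)
proof -
  have "?A \<and> ?B \<and> ?C"
    using assms(1,2)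
  proof (induction i arbitrary: st xs)
    case (Suc i)
    have "set (survivors P f st xs) \<subseteq> U" "set (survivors P f st xs) \<inter> S = {}"
      using survivors_subset[of P f st xs] Suc.prems by auto
    note IH = Suc.IH[OF this]
    note ask = play_ask_each[OF Suc.prems, of A n \<rho> "\<lambda>ys. rounds i ys K" st, folded P_def f_def]
    show ?case
      using IH[of "foldl f st xs"] by (simp add: ask Un_assoc image_Un)
  qed auto
  then show ?A ?B ?C by auto
qed

lemma play_adds:
  fixes A :: amq and \<rho> :: random_string and st :: state
  assumes "distinct ys" "set ys \<subseteq> U" "set ys \<inter> S = {}" "finite S" "card S + length ys \<le> n"
  defines "st' \<equiv> foldl (\<lambda>st y. Insert A st y \<rho>) st ys"
  shows "set (fst (play A U n \<rho> t (S \<union> set ys, st')))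
           \<subseteq> set (fst (play A U n \<rho> (foldr Add ys t) (S, st)))" (is ?A)
    and "last (fst (play A U n \<rho> (foldr Add ys t) (S, st))) =
           last (fst (play A U n \<rho> t (S \<union> set ys, st')))" (is ?B)
    and "snd (play A U n \<rho> (foldr Add ys t) (S, st)) =
           snd (play A U n \<rho> t (S \<union> set ys, st'))" (is ?C)
proof -
  have "?A \<and> ?B \<and> ?C"
    using assms(1-5) unfolding st'_def
  proof (induction ys arbitrary: S st)
    case (Cons y ys)
    have "do_insert A U n \<rho> y (S, st) = (insert y S, Insert A st y \<rho>)"
      using Cons.prems by (auto simp: do_insert_def)
    moreover note Cons.IH[of "insert y S" "Insert A st y \<rho>"]
    ultimately show ?case
      using Cons.prems by (auto simp: case_prod_unfold Let_def)
  qed auto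
  then show ?A ?B ?C by auto
qed

text \<open>The output lies in \<open>U\<close> and is not stored, so its lookup alone decides. The
  state reached is the one in which the full attack would make this very query.\<close>

lemma probe_wins_iff:
  fixes A :: amq and \<rho> :: random_string and \<epsilon> :: real and i r :: nat and s' :: state
  assumes "distinct ys" "set ys \<subseteq> U" "length ys = n" "set xs \<subseteq> U" "set xs \<inter> set ys = {}"
  defines "P \<equiv> present A \<rho>" and "f \<equiv> respond A \<rho>"
  defines "s \<equiv> foldl (\<lambda>st y. Insert A st y \<rho>) (Build A n \<epsilon> \<rho>) ys"
  assumes stage: "stage P f i s xs = (s', zs)" "zs \<noteq> []"
  defines "j \<equiv> r mod length zs"
  shows "wins A U n \<epsilon> \<rho> (probe ys xs i r) \<longleftrightarrow> P (foldl f s' (take j zs)) (zs ! j)"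
proof -
  have zs: "set zs \<subseteq> set xs"
    using stage_subset[of P f i s xs] stage by simp
  have take: "set (take j zs) \<subseteq> U" "set (take j zs) \<inter> set ys = {}"
    using zs assms set_take_subset[of j zs] by blast+
  have "j < length zs"
    using stage by (simp add: j_def)
  then have "zs ! j \<in> U" "zs ! j \<notin> set ys"
    using zs assms nth_mem by blast+
  moreover have "last (fst (game A U n \<epsilon> \<rho> (probe ys xs i r))) = (set ys, foldl f s' (take j zs))"
    "snd (game A U n \<epsilon> \<rho> (probe ys xs i r)) = zs ! j"
    unfolding game_def probe_def
    using assms(1-5) stage play_ask_each[OF take] play_rounds[OF assms(4,5)]
    by (simp_all add: play_adds flip: P_def f_def s_def j_def)
  ultimately show ?thesis
    by (simp add: wins_def case_prod_unfold Let_def P_def present_def)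
qed

text \<open>Few bits keep every visited state in \<open>B\<close>; the absence of false negatives
  puts \<open>ys\<close> into the shared set; a good sample then has a large shared set, hence a
  survivor of all \<open>k\<close> rounds, and \<open>sum_ratio_ge\<close> bounds the total success
  of the probes.\<close>

lemma probes_win_often:
  assumes nfn: "no_false_negatives A U n \<epsilon>"
    and U: "finite U" and ys: "ys \<in> lists_of U n" and xs: "xs \<in> lists_of U q" and pos: "k > 0"
    and B: "\<And>st. real (length (fst st) + length (snd st)) < s \<Longrightarrow> st \<in> B"
    and small: "\<not> needs_space A U n \<epsilon> s \<rho> (full_attack k ys xs)"
    and good: "\<not> bad_sample (present A \<rho>) (respond A \<rho>) U B b k ys xs"
  shows "(\<Sum>i<k. \<Sum>r<fact q. of_bool (wins A U n \<epsilon> \<rho> (probe ys xs i r))) \<ge> fact q * (k - ln q)"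
proof -
  define P where "P = present A \<rho>"
  define f where "f = respond A \<rho>"
  define s0 where "s0 = foldl (\<lambda>st y. Insert A st y \<rho>) (Build A n \<epsilon> \<rho>) ys"
  let ?ss = "starts P f k s0 xs"
  let ?V = "thread_visited P f ?ss xs"
  have lists: "set ys \<subseteq> U" "length ys = n" "set xs \<subseteq> U" "length xs = q"
    using ys xs by (auto simp: lists_of_def)
  have disj: "distinct ys" "set xs \<inter> set ys = {}"
    using good by (auto simp: bad_sample_def)
  have "set (fst (play A U n \<rho> (rounds k xs (\<lambda>_. Output 0)) (set ys, s0)))
      \<subseteq> set (fst (game A U n \<epsilon> \<rho> (full_attack k ys xs)))"
    using play_adds(1)[of ys U "{}" n A \<rho> "rounds k xs (\<lambda>_. Output 0)" "Build A n \<epsilon> \<rho>"] lists disj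
    by (simp add: game_def full_attack_def s0_def)
  moreover have "Pair (set ys) ` ?V \<subseteq> set (fst (play A U n \<rho> (rounds k xs (\<lambda>_. Output 0)) (set ys, s0)))"
    unfolding P_def f_def by (subst play_rounds(1)[OF lists(3) disj(2)]) (rule Un_upper1)
  ultimately have configs: "(set ys, st) \<in> set (fst (game A U n \<epsilon> \<rho> (full_attack k ys xs)))"
    if "st \<in> ?V" for st
    using that by blast
  have "card (set ys) = n"
    using lists disj by (simp add: distinct_card)
  have "?V \<subseteq> B"
  proof
    fix st assume "st \<in> ?V"
    from configs[OF this] have "\<not> s \<le> real (length (fst st) + length (snd st))"
      using small \<open>card (set ys) = n\<close> unfolding needs_space_def
      by (force simp: case_prod_unfold)
    then show "st \<in> B"
      by (intro B) simp
  qed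
  moreover have "set ?ss \<subseteq> ?V"
    by (rule threads_subset_visited)
  ultimately have ss: "?ss \<in> lists_of B k"
    by (auto simp: lists_of_def)
  moreover have "s0 \<in> set ?ss"
    using pos by (cases k) auto
  ultimately have s0: "s0 \<in> B"
    by (auto simp: lists_of_def)
  have "P st x" if "st \<in> ?V" "x \<in> set ys" for st x
    using nfn configs[OF that(1)] that(2)
    unfolding no_false_negatives_def P_def present_def by (force simp: case_prod_unfold)
  then have "set ys \<subseteq> shared P f U k s0 xs"
    using lists by (auto simp: shared_def)
  then have "b \<le> card (shared P f U k s0 xs)"
    using good s0 unfolding bad_sample_def P_def f_def by (meson not_le)
  then have "dense P f U b ?ss xs"
    using dense_if_visited[OF U] by (simp add: shared_def)
  then have alive: "snd (stage P f k s0 xs) \<noteq> []"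
    using good ss unfolding thread_survivors_starts[symmetric] bad_sample_def P_def f_def by blast
  \<comment> \<open>Sizes of the rounds. Up to \<open>k\<close> they decrease from \<open>q\<close>
    and stay positive, so the ratios make sense and every \<open>a i\<close> divides
    \<open>fact q\<close>.\<close>
  define a where "a i = length (snd (stage P f i s0 xs))" for i
  have step: "a (Suc i) = length (survivors P f (fst (stage P f i s0 xs)) (snd (stage P f i s0 xs)))" for i
    unfolding a_def stage_Suc by (simp add: case_prod_unfold Let_def)
  then have "antimono a"
    unfolding antimono_iff_le_Suc by (auto simp: a_def length_survivors_le)
  moreover have "a k \<ge> 1" "a 0 = q"
    using alive lists by (simp_all add: a_def Suc_le_eq)
  ultimately have a: "a i \<ge> 1" "a i \<le> q" if "i \<le> k" for i
    using that antimonoD[of a i k] antimonoD[of a 0 i] by auto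
  have "(\<Sum>r<fact q. of_bool (wins A U n \<epsilon> \<rho> (probe ys xs i r))) = fact q * (a (Suc i) / a i)"
    if "i < k" for i
  proof -
    obtain s' zs where zs: "stage P f i s0 xs = (s', zs)"
      by fastforce
    then have len: "length zs = a i"
      by (simp add: a_def)
    then have "zs \<noteq> []" using a[of i] that by auto
    then have win: "wins A U n \<epsilon> \<rho> (probe ys xs i r) \<longleftrightarrow>
        P (foldl f s' (take (r mod a i) zs)) (zs ! (r mod a i))" for r
      using probe_wins_iff[of ys U n xs A \<rho> i \<epsilon> s' zs r] lists disj zs len
      by (simp add: P_def f_def s0_def)
    have "a i dvd fact q" "a i > 0"
      using a[of i] that by (auto intro!: dvd_fact)
    from count_mod[OF this, of "\<lambda>j. P (foldl f s' (take j zs)) (zs ! j)"]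
    have "real (a i) * (\<Sum>r<fact q. of_bool (wins A U n \<epsilon> \<rho> (probe ys xs i r))) = fact q * a (Suc i)"
      using card_present_survivors[of zs P f s'] step[of i] zs len
      by (simp add: win del: sum_of_bool_eq)
    then show ?thesis
      using \<open>a i > 0\<close> by (simp add: field_simps)
  qed
  then have "(\<Sum>i<k. \<Sum>r<fact q. of_bool (wins A U n \<epsilon> \<rho> (probe ys xs i r)))
      = fact q * (\<Sum>i<k. a (Suc i) / a i)"
    by (simp add: sum_distrib_left)
  also have "\<dots> \<ge> fact q * (k - ln (a 0))"
    using sum_ratio_ge[of k "\<lambda>i. real (a i)"] a by (intro mult_left_mono) auto
  finally show ?thesis
    using \<open>a 0 = q\<close> by simp
qed

section \<open>Averaging over the random string\<close>

instance answer :: countable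
  by countable_datatype

lemma prob_space_random_strings: "prob_space random_strings"
  unfolding random_strings_def by (intro prob_space_PiM measure_pmf.prob_space_axioms)

lemma space_random_strings [simp]: "space random_strings = UNIV"
  by (simp add: random_strings_def space_PiM)

text \<open>The state after a move depends on the random string but has countably many values.
  Measurability for each fixed successor state, given by induction on the decision tree, therefore
  carries over to the composition.\<close>

lemma measurable_play:
  assumes A: "amq_measurable A"
  shows "(\<lambda>\<rho>. play A U n \<rho> t (S, st)) \<in> measurable random_strings (count_space UNIV)"
proof (induction t arbitrary: S st)
  case (Ask x k)
  define rest where "rest b st' \<rho> = map_prod (Cons (S, st)) id (play A U n \<rho> (k b) (S, st'))"
    for b st' \<rho>
  have rest: "rest b st' \<in> measurable random_strings (count_space UNIV)" for b st'
    unfolding rest_def by (rule measurable_compose[OF Ask[OF rangeI[of k b], of S st'], of "map_prod (Cons (S, st)) id"]) auto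
  show ?case
  proof (cases "x \<in> U")
    case True
    define succ where "succ w \<rho> =
      (if snd w = Present \<and> x \<notin> S then Update A (fst w, snd st) x \<rho> else (fst w, snd st))" for w \<rho>
    have succ: "succ w \<in> measurable random_strings (count_space UNIV)" for w
    proof -
      have "succ w = (if snd w = Present \<and> x \<notin> S then Update A (fst w, snd st) x
          else (\<lambda>_. (fst w, snd st)))"
        by (auto simp: succ_def fun_eq_iff)
      then show ?thesis
        using A by (simp add: amq_measurable_def del: split_paired_All)
    qed
    have "(\<lambda>\<rho>. rest (snd w) (succ w \<rho>) \<rho>) \<in> measurable random_strings (count_space UNIV)" for w
      by (rule measurable_compose_countable[of "rest (snd w)", OF rest succ])
    moreover have "Lookup A (fst st) x \<in> measurable random_strings (count_space UNIV)"
      using A by (simp add: amq_measurable_def del: split_paired_All)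
    ultimately have "(\<lambda>\<rho>. rest (snd (Lookup A (fst st) x \<rho>)) (succ (Lookup A (fst st) x \<rho>) \<rho>) \<rho>)
        \<in> measurable random_strings (count_space UNIV)"
      by (rule measurable_compose_countable[of "\<lambda>w \<rho>. rest (snd w) (succ w \<rho>) \<rho>"])
    moreover have "play A U n \<rho> (Ask x k) (S, st) =
        rest (snd (Lookup A (fst st) x \<rho>)) (succ (Lookup A (fst st) x \<rho>) \<rho>) \<rho>" for \<rho>
      using True
      by (cases st; cases "Lookup A (fst st) x \<rho>") (simp add: do_lookup_def rest_def succ_def map_prod_def)
    ultimately show ?thesis
      by (simp only:)
  next
    case False
    then have "play A U n \<rho> (Ask x k) (S, st) = rest Absent st \<rho>" for \<rho>
      by (cases st) (simp add: do_lookup_def rest_def map_prod_def)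
    then show ?thesis
      using rest by (simp only:)
  qed
next
  case (Add x t)
  define succ where "succ \<rho> = (if x \<in> U \<and> x \<notin> S \<and> card S < n then Insert A st x \<rho> else st)" for \<rho>
  define S' where "S' = (if x \<in> U \<and> x \<notin> S \<and> card S < n then insert x S else S)"
  define rest where "rest st' \<rho> = map_prod (Cons (S, st)) id (play A U n \<rho> t (S', st'))" for st' \<rho>
  have rest: "rest st' \<in> measurable random_strings (count_space UNIV)" for st'
    unfolding rest_def by (rule measurable_compose[OF Add[of S' st'], of "map_prod (Cons (S, st)) id"]) auto
  have "succ \<in> measurable random_strings (count_space UNIV)"
  proof -
    have "succ = (if x \<in> U \<and> x \<notin> S \<and> card S < n then Insert A st x else (\<lambda>_. st))"
      by (auto simp: succ_def fun_eq_iff)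
    then show ?thesis
      using A by (simp add: amq_measurable_def del: split_paired_All)
  qed
  then have "(\<lambda>\<rho>. rest (succ \<rho>) \<rho>) \<in> measurable random_strings (count_space UNIV)"
    by (rule measurable_compose_countable[of rest, OF rest])
  moreover have "play A U n \<rho> (Add x t) (S, st) = rest (succ \<rho>) \<rho>" for \<rho>
    by (simp add: do_insert_def rest_def succ_def S'_def map_prod_def)
  ultimately show ?case
    by (simp only:)
next
  case (Remove x t)
  define succ where "succ \<rho> = (if x \<in> S then Delete A st x \<rho> else st)" for \<rho>
  define S' where "S' = (if x \<in> S then S - {x} else S)"
  define rest where "rest st' \<rho> = map_prod (Cons (S, st)) id (play A U n \<rho> t (S', st'))" for st' \<rho>
  have rest: "rest st' \<in> measurable random_strings (count_space UNIV)" for st'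
    unfolding rest_def by (rule measurable_compose[OF Remove[of S' st'], of "map_prod (Cons (S, st)) id"]) auto
  have "succ \<in> measurable random_strings (count_space UNIV)"
  proof -
    have "succ = (if x \<in> S then Delete A st x else (\<lambda>_. st))"
      by (auto simp: succ_def fun_eq_iff)
    then show ?thesis
      using A by (simp add: amq_measurable_def del: split_paired_All)
  qed
  then have "(\<lambda>\<rho>. rest (succ \<rho>) \<rho>) \<in> measurable random_strings (count_space UNIV)"
    by (rule measurable_compose_countable[of rest, OF rest])
  moreover have "play A U n \<rho> (Remove x t) (S, st) = rest (succ \<rho>) \<rho>" for \<rho>
    by (simp add: do_delete_def rest_def succ_def S'_def map_prod_def)
  ultimately show ?case
    by (simp only:)
next
  case (Output y)
  show ?case by simp
qed

lemma measurable_game: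
  assumes "amq_measurable A"
  shows "(\<lambda>\<rho>. game A U n \<epsilon> \<rho> t) \<in> measurable random_strings (count_space UNIV)"
  unfolding game_def
proof (rule measurable_compose_countable[of "\<lambda>st \<rho>. play A U n \<rho> t ({}, st)"])
  show "Build A n \<epsilon> \<in> measurable random_strings (count_space UNIV)"
    using assms by (simp add: amq_measurable_def)
qed (rule measurable_play[OF assms])

lemma measurable_fun_game:
  assumes "amq_measurable A"
  shows "(\<lambda>\<rho>. h (game A U n \<epsilon> \<rho> t)) \<in> measurable random_strings (count_space UNIV)"
  by (rule measurable_compose[OF measurable_game[OF assms, of U n \<epsilon> t], of h]) simp

lemma needs_space_measurable:
  assumes "amq_measurable A"
  shows "Measurable.pred random_strings (\<lambda>\<rho>. needs_space A U n \<epsilon> s \<rho> t)"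
  unfolding needs_space_def
  by (rule measurable_fun_game[OF assms, of "\<lambda>G. \<exists>(S, L, R)\<in>set (fst G).
    card S = n \<and> real (length L + length R) \<ge> s" U n \<epsilon> t])

text \<open>Winning is not a function of the transcript alone, since the final lookup consults the
  random string again; that lookup is composed with the countably many values of final local state
  and output.\<close>

lemma wins_measurable:
  assumes "amq_measurable A"
  shows "Measurable.pred random_strings (\<lambda>\<rho>. wins A U n \<epsilon> \<rho> t)"
proof -
  define fin where "fin G = (fst (snd (last (fst G))), snd G)" for G :: "config list \<times> nat"
  define yes where "yes w \<rho> \<longleftrightarrow> snd (Lookup A (fst w) (snd w) \<rho>) = Present" for w \<rho>
  define out where "out G \<longleftrightarrow> snd G \<in> U \<and> snd G \<notin> fst (last (fst G))" for G :: "config list \<times> nat"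
  let ?g = "\<lambda>\<rho>. game A U n \<epsilon> \<rho> t"
  have "Measurable.pred random_strings (yes w)" for w
  proof -
    have "Lookup A (fst w) (snd w) \<in> measurable random_strings (count_space UNIV)"
      using assms by (simp add: amq_measurable_def)
    from measurable_compose[OF this, of "\<lambda>a. snd a = Present" "count_space UNIV"]
    show ?thesis
      unfolding yes_def[abs_def] by simp
  qed
  then have "Measurable.pred random_strings (\<lambda>\<rho>. yes (fin (?g \<rho>)) \<rho>)"
    by (rule measurable_compose_countable[of yes])
      (rule measurable_fun_game[OF assms, of fin U n \<epsilon> t])
  moreover have "Measurable.pred random_strings (\<lambda>\<rho>. out (?g \<rho>))"
    by (rule measurable_fun_game[OF assms])
  ultimately have "Measurable.pred random_strings (\<lambda>\<rho>. out (?g \<rho>) \<and> yes (fin (?g \<rho>)) \<rho>)"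
    by (rule pred_intros_logic(3)[rotated])
  moreover have "wins A U n \<epsilon> \<rho> t \<longleftrightarrow> out (?g \<rho>) \<and> yes (fin (?g \<rho>)) \<rho>" for \<rho>
    by (simp add: wins_def out_def yes_def fin_def case_prod_unfold Let_def)
  ultimately show ?thesis
    by (simp only:)
qed

text \<open>Exchanges the average over strategies with the integral over the random string, so that
  two adversaries can be compared for each fixed random string.\<close>

lemma game_prob_uniform:
  assumes X: "finite X" "X \<noteq> {}"
    and E: "\<And>x. x \<in> X \<Longrightarrow> Measurable.pred random_strings (\<lambda>\<rho>. E \<rho> (h x))"
  shows "game_prob (map_pmf h (pmf_of_set X)) E =
      (\<integral>\<rho>. (\<Sum>x\<in>X. of_bool (E \<rho> (h x))) / card X \<partial>random_strings)"
    and "integrable random_strings (\<lambda>\<rho>. (\<Sum>x\<in>X. of_bool (E \<rho> (h x))) / card X :: real)"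
proof -
  interpret prob_space random_strings
    by (rule prob_space_random_strings)
  have int: "integrable random_strings (\<lambda>\<rho>. of_bool (E \<rho> (h x)) :: real)" if "x \<in> X" for x
    using E[OF that] by (intro integrable_const_bound[where B = 1]) auto
  have prob: "prob {\<rho>. E \<rho> (h x)} = (\<integral>\<rho>. of_bool (E \<rho> (h x)) \<partial>random_strings)" if "x \<in> X" for x
  proof -
    have "(\<integral>\<rho>. indicat_real {\<rho>. E \<rho> (h x)} \<rho> \<partial>random_strings) = prob {\<rho>. E \<rho> (h x)}"
      by simp
    then show ?thesis
      by (simp add: indicator_def of_bool_def)
  qed
  have "game_prob (map_pmf h (pmf_of_set X)) E = (\<Sum>x\<in>X. prob {\<rho>. E \<rho> (h x)}) / card X"
    using X by (simp add: game_prob_def integral_pmf_of_set)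
  also have "\<dots> = (\<Sum>x\<in>X. \<integral>\<rho>. of_bool (E \<rho> (h x)) \<partial>random_strings) / card X"
    using prob by simp
  also have "\<dots> = (\<integral>\<rho>. (\<Sum>x\<in>X. of_bool (E \<rho> (h x))) / card X \<partial>random_strings)"
    using int by (simp add: Bochner_Integration.integral_sum del: sum_of_bool_eq)
  finally show "game_prob (map_pmf h (pmf_of_set X)) E =
      (\<integral>\<rho>. (\<Sum>x\<in>X. of_bool (E \<rho> (h x))) / card X \<partial>random_strings)" .
  show "integrable random_strings (\<lambda>\<rho>. (\<Sum>x\<in>X. of_bool (E \<rho> (h x))) / card X :: real)"
    using int by (intro integrable_divide Bochner_Integration.integrable_sum) auto
qed

text \<open>Compares two uniform adversaries: the full attack, and the probe in a random round at a
  random position. For each random string, lack of space turns into wins of the probe up to the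
  error terms; it remains to integrate and to apply the sustained rate to the probe.\<close>

lemma space_bound:
  fixes b :: real and B :: "state set"
  assumes A: "is_amq A U n \<epsilon>" "sustained_fpr A U n \<epsilon>"
    and U: "finite U" "0 \<le> b" "b \<le> card U" "card U > 0" and pos: "k > 0"
    and B: "finite B" "\<And>st. real (length (fst st) + length (snd st)) < s \<Longrightarrow> st \<in> B"
  shows "\<exists>\<A>. game_prob \<A> (needs_space A U n \<epsilon> s) \<ge> 1 - \<epsilon> -
    (ln q / k + (real n ^ 2 + real q * real n) / card U + card B * (b / card U) ^ n
      + real (card B) ^ k * (1 - b / card U) ^ q)"
proof -
  interpret prob_space random_strings
    by (rule prob_space_random_strings)
  have total: "prob UNIV = 1"
    using prob_space by simp
  let ?u = "real (card U)"
  define Y where "Y = lists_of U n"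
  define X where "X = lists_of U q"
  define \<Omega> where "\<Omega> = Y \<times> X"
  define Z where "Z = \<Omega> \<times> {..<k} \<times> {..<fact q :: nat}"
  define full where "full = (\<lambda>(ys, xs). full_attack k ys xs)"
  define prb where "prb = (\<lambda>((ys, xs), i, r). probe ys xs i r)"
  define err where "err = (real n ^ 2 + real q * real n) / ?u + card B * (b / ?u) ^ n
      + real (card B) ^ k * (1 - b / ?u) ^ q"
  have cards: "real (card Y) = ?u ^ n" "real (card X) = ?u ^ q" "real (card \<Omega>) = ?u ^ n * ?u ^ q"
    using U by (simp_all add: Y_def X_def \<Omega>_def card_lists_of card_cartesian_product)
  have fin: "finite Y" "finite X" "finite \<Omega>" "finite Z"
    using U by (simp_all add: Y_def X_def \<Omega>_def Z_def)
  have \<Omega>pos: "real (card \<Omega>) > 0"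
    using U unfolding cards by simp
  then have ne: "\<Omega> \<noteq> {}" by auto
  then have neZ: "Z \<noteq> {}"
    using pos by (auto simp: Z_def lessThan_empty_iff)
  have cardZ: "real (card Z) = card \<Omega> * (real k * fact q)"
    by (simp add: Z_def card_cartesian_product)
  let ?need = "needs_space A U n \<epsilon> s" and ?win = "wins A U n \<epsilon>"
  have nfn: "no_false_negatives A U n \<epsilon>" and meas: "amq_measurable A"
    using A by (auto simp: is_amq_def)
  have pointwise: "1 - (\<Sum>\<omega>\<in>\<Omega>. of_bool (?need \<rho> (full \<omega>))) / card \<Omega>
      \<le> (\<Sum>z\<in>Z. of_bool (?win \<rho> (prb z))) / card Z + (ln q / k + err)" for \<rho>
  proof -
    let ?bad = "\<lambda>\<omega>. bad_sample (present A \<rho>) (respond A \<rho>) U B b k (fst \<omega>) (snd \<omega>)"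
    let ?W = "\<lambda>\<omega>. \<Sum>i<k. \<Sum>r<fact q. of_bool (?win \<rho> (prb (\<omega>, i, r))) :: real"
    \<comment> \<open>For \<open>q = 0\<close> this rests on the convention
      \<open>ln 0 = 0\<close>.\<close>
    have lnq: "ln q \<ge> 0"
      by (cases "q = 0") auto
    \<comment> \<open>Enough space makes the left side 0, a bad sample makes the last term 1; in the
      remaining case \<open>probes_win_often\<close> applies.\<close>
    have one: "1 - of_bool (?need \<rho> (full \<omega>)) \<le> ?W \<omega> / (k * fact q) + ln q / k + of_bool (?bad \<omega>)"
      if \<omega>: "\<omega> \<in> \<Omega>" for \<omega>
    proof (cases "?need \<rho> (full \<omega>) \<or> ?bad \<omega>")
      case True
      moreover have "?W \<omega> \<ge> 0"
        by (intro sum_nonneg) auto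
      then have "?W \<omega> / (k * fact q) + ln q / k \<ge> 0"
        using lnq by (intro add_nonneg_nonneg divide_nonneg_nonneg) auto
      ultimately show ?thesis by (auto simp: of_bool_def)
    next
      case False
      then have "\<not> ?need \<rho> (full_attack k (fst \<omega>) (snd \<omega>))" "\<not> ?bad \<omega>"
        by (auto simp: full_def case_prod_unfold)
      moreover have "fst \<omega> \<in> lists_of U n" "snd \<omega> \<in> lists_of U q"
        using \<omega> by (auto simp: \<Omega>_def Y_def X_def)
      ultimately have "fact q * (k - ln q) \<le> ?W \<omega>"
        using probes_win_often[OF nfn U(1) _ _ pos B(2)]
        by (simp add: prb_def case_prod_unfold del: sum_of_bool_eq)
      then show ?thesis
        using False pos by (simp add: field_simps del: sum_of_bool_eq)
    qed
    have "real (card \<Omega>) - (\<Sum>\<omega>\<in>\<Omega>. of_bool (?need \<rho> (full \<omega>))) = (\<Sum>\<omega>\<in>\<Omega>. 1 - of_bool (?need \<rho> (full \<omega>)) :: real)"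
      by (simp add: sum_subtractf del: sum_of_bool_eq)
    also have "\<dots> \<le> (\<Sum>\<omega>\<in>\<Omega>. ?W \<omega> / (k * fact q) + ln q / k + of_bool (?bad \<omega>))"
      by (intro sum_mono one)
    also have "\<dots> = (\<Sum>\<omega>\<in>\<Omega>. ?W \<omega>) / (k * fact q) + card \<Omega> * (ln q / k) + (\<Sum>\<omega>\<in>\<Omega>. of_bool (?bad \<omega>))"
      by (simp add: sum.distrib sum_divide_distrib del: sum_of_bool_eq)
    \<comment> \<open>The count of bad samples holds for an arbitrary automaton, hence for
      \<open>present\<close> and \<open>respond\<close> under every random string.\<close>
    also have "(\<Sum>\<omega>\<in>\<Omega>. of_bool (?bad \<omega>) :: real) \<le> card \<Omega> * err"
    proof -
      have "(\<Sum>\<omega>\<in>\<Omega>. of_bool (?bad \<omega>) :: real) =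
          (\<Sum>ys\<in>Y. \<Sum>xs\<in>X. of_bool (bad_sample (present A \<rho>) (respond A \<rho>) U B b k ys xs))"
        unfolding \<Omega>_def sum.cartesian_product by (simp add: case_prod_unfold del: sum_of_bool_eq)
      also have "\<dots> \<le> (real n ^ 2 + real q * real n) / card U * real (card U) ^ n * real (card U) ^ q
          + card B * b ^ n * real (card U) ^ q
          + real (card B) ^ k * (card U - b) ^ q * real (card U) ^ n"
        unfolding Y_def X_def by (intro count_bad_sample U B)
      also have "b ^ n = (b / ?u) ^ n * ?u ^ n"
        using U by (auto simp: power_divide)
      also have "card U - b = (1 - b / ?u) * ?u"
        using U(4) by (simp add: left_diff_distrib)
      also have "\<dots> ^ q = (1 - b / ?u) ^ q * ?u ^ q"
        by (rule power_mult_distrib)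
      finally show ?thesis
        unfolding cards err_def by (simp add: algebra_simps)
    qed
    also have "(\<Sum>\<omega>\<in>\<Omega>. ?W \<omega>) = (\<Sum>z\<in>Z. of_bool (?win \<rho> (prb z)))"
      unfolding Z_def sum.cartesian_product by (simp add: case_prod_unfold del: sum_of_bool_eq)
    finally have "(real (card \<Omega>) - (\<Sum>\<omega>\<in>\<Omega>. of_bool (?need \<rho> (full \<omega>)))) / card \<Omega> \<le>
        ((\<Sum>z\<in>Z. of_bool (?win \<rho> (prb z))) / (k * fact q) + card \<Omega> * (ln q / k) + card \<Omega> * err) / card \<Omega>"
      by (intro divide_right_mono) auto
    then show ?thesis
      using \<Omega>pos unfolding cardZ by (simp add: diff_divide_distrib add_divide_distrib mult.commute del: sum_of_bool_eq)
  qed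
  note need = game_prob_uniform[where h = full and E = ?need, OF fin(3) ne needs_space_measurable[OF meas]]
  note win = game_prob_uniform[where h = prb and E = ?win, OF fin(4) neZ wins_measurable[OF meas]]
  have "1 - game_prob (map_pmf full (pmf_of_set \<Omega>)) ?need =
      (\<integral>\<rho>. 1 - (\<Sum>\<omega>\<in>\<Omega>. of_bool (?need \<rho> (full \<omega>))) / card \<Omega> \<partial>random_strings)"
    unfolding need(1) by (subst Bochner_Integration.integral_diff[OF _ need(2)]) (auto simp: total)
  also have "\<dots> \<le> (\<integral>\<rho>. (\<Sum>z\<in>Z. of_bool (?win \<rho> (prb z))) / card Z + (ln q / k + err) \<partial>random_strings)"
    using pointwise need(2) win(2)
    by (intro integral_mono Bochner_Integration.integrable_diff Bochner_Integration.integrable_add) auto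
  also have "\<dots> = game_prob (map_pmf prb (pmf_of_set Z)) ?win + (ln q / k + err)"
    unfolding win(1) by (subst Bochner_Integration.integral_add[OF win(2)]) (auto simp: total)
  also have "game_prob (map_pmf prb (pmf_of_set Z)) ?win \<le> \<epsilon>"
    using A by (auto simp: sustained_fpr_def)
  finally have "game_prob (map_pmf full (pmf_of_set \<Omega>)) ?need \<ge> 1 - \<epsilon> - (ln q / k + err)"
    by simp
  then show ?thesis
    unfolding err_def by (intro exI[of _ "map_pmf full (pmf_of_set \<Omega>)"]) (simp add: algebra_simps)
qed

section \<open>Choice of parameters\<close>

lemma finite_small_states:
  "finite {st :: state. real (length (fst st) + length (snd st)) < s}" (is ?A)
  and card_small_states:
  "s \<ge> 0 \<Longrightarrow> card {st :: state. real (length (fst st) + length (snd st)) < s} \<le> 4 powr (s + 1)"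
proof -
  \<comment> \<open>Each of the two components has at most \<open>m\<close> bits, hence fewer than
    \<open>2 ^ Suc m\<close> values; the pair accounts for the base 4.\<close>
  define m where "m = nat \<lfloor>s\<rfloor>"
  define T where "T = {xs :: bits. set xs \<subseteq> UNIV \<and> length xs \<le> m}"
  have sub: "{st :: state. real (length (fst st) + length (snd st)) < s} \<subseteq> T \<times> T"
    by (auto simp: T_def m_def) linarith+
  have fin: "finite T"
    unfolding T_def by (rule finite_lists_length_le) simp
  then show ?A
    using sub finite_subset by blast
  have "card T = (\<Sum>i\<le>m. 2 ^ i)"
    unfolding T_def by (subst card_lists_length_le) auto
  also have "\<dots> = 2 ^ Suc m - 1"
    by (induction m) auto
  finally have "real (card T) \<le> 2 ^ Suc m"
    by simp
  then have T: "real (card T) * real (card T) \<le> 2 ^ Suc m * 2 ^ Suc m"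
    by (intro mult_mono) auto
  assume s: "s \<ge> 0"
  have "real (card {st :: state. real (length (fst st) + length (snd st)) < s}) \<le> card (T \<times> T)"
    using sub fin by (intro of_nat_mono card_mono) auto
  also have "\<dots> \<le> 4 ^ Suc m"
    using T by (simp add: card_cartesian_product flip: power_mult_distrib)
  also have "\<dots> = 4 powr (m + 1)"
    by (simp add: powr_add powr_realpow)
  also have "\<dots> \<le> 4 powr (s + 1)"
    using s by (intro powr_mono) (auto simp: m_def)
  finally show "card {st :: state. real (length (fst st) + length (snd st)) < s} \<le> 4 powr (s + 1)" .
qed

text \<open>The four errors of \<open>space_bound\<close> for \<open>q = n ^ 2\<close>, about
  \<open>n powr (1/4)\<close> rounds, density \<open>n powr - (1/4)\<close> and
  \<open>n / 16 * log 2 n\<close> bits. The exponent tends to minus infinity as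
  \<open>n powr (5/4) * ln n\<close> is of lower order than \<open>n powr (7/4)\<close>; the first
  term dominates and is eventually below \<open>n powr - (1/8)\<close>.\<close>

lemma error_small:
  "eventually (\<lambda>n. 2 * ln (real n) / real n powr (1/4) + 2 / real n + 4 * real n powr (- real n / 8)
     + exp ((real n powr (1/4) + 1) * (ln 4 + real n / 8 * ln (real n)) - real n powr (7/4))
     \<le> real n powr (- (1/8))) sequentially"
  by real_asymp

theorem theorem1:
  fixes \<epsilon> :: real
  assumes "\<epsilon> < 1"
  shows "\<exists>c>0. \<exists>d>0. \<exists>N. \<forall>n\<ge>N. \<forall>(U :: nat set) (A :: amq).
    finite U \<and> card U > n ^ 4 \<and> is_amq A U n \<epsilon> \<and> sustained_fpr A U n \<epsilon> \<longrightarrow>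
    (\<exists>\<A>. game_prob \<A> (needs_space A U n \<epsilon>
          (c * min (real n * log 2 (real n)) (real n * log 2 (log 2 (real (card U))))))
        \<ge> 1 - \<epsilon> - real n powr - d)"
proof -
  from error_small obtain N0 where N0: "\<And>n. n \<ge> N0 \<Longrightarrow>
      2 * ln (real n) / real n powr (1/4) + 2 / real n + 4 * real n powr (- real n / 8)
     + exp ((real n powr (1/4) + 1) * (ln 4 + real n / 8 * ln (real n)) - real n powr (7/4))
     \<le> real n powr (- (1/8))"
    unfolding eventually_sequentially by auto
  have main: "\<exists>\<A>. game_prob \<A> (needs_space A U n \<epsilon>
          (1/16 * min (real n * log 2 (real n)) (real n * log 2 (log 2 (real (card U))))))
        \<ge> 1 - \<epsilon> - real n powr - (1/8)"
    if n: "n \<ge> max N0 2" and U: "finite U" "card U > n ^ 4"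
      and A: "is_amq A U n \<epsilon>" "sustained_fpr A U n \<epsilon>" for n U A
  proof -
    define m where "m = real n"
    have m: "m \<ge> 2" using n by (simp add: m_def)
    let ?s' = "1/16 * min (m * log 2 m) (m * log 2 (log 2 (real (card U))))"
    \<comment> \<open>The factor \<open>1/16\<close> gives \<open>4 powr s = m powr (m / 8)\<close>,
      few enough states to be outweighed by \<open>\<beta> ^ n = m powr (- m / 4)\<close>.\<close>
    define s where "s = m / 16 * log 2 m"
    define B where "B = {st :: state. real (length (fst st) + length (snd st)) < s}"
    \<comment> \<open>Enough rounds to make \<open>ln q / k\<close> small, yet few enough for the
      union bound over \<open>k\<close> states to stay asymptotically below
      \<open>exp (m powr (7/4))\<close>.\<close>
    define k where "k = nat \<lceil>m powr (1/4)\<rceil>"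
    define \<beta> where "\<beta> = m powr (- (1/4))"
    let ?u = "real (card U)"
    have s: "s \<ge> 0" "?s' \<le> s"
      using m by (auto simp: s_def min_def)
    have u: "?u > 0" using U(2) by auto
    have \<beta>: "0 \<le> \<beta>" "\<beta> \<le> 1"
      using m powr_mono[of "- (1/4)" 0 m] by (auto simp: \<beta>_def)
    have root: "m powr (1/4) > 0"
      using m by simp
    then have k: "k > 0" "m powr (1/4) \<le> k" "k \<le> m powr (1/4) + 1"
      unfolding k_def by linarith+
    have "4 powr s = (2 powr 2) powr s"
      by simp
    also have "\<dots> = (2 powr log 2 m) powr (m / 8)"
      unfolding powr_powr s_def by (simp add: mult.commute)
    finally have four: "4 powr s = m powr (m / 8)"
      using m by simp
    have B: "real (card B) \<le> 4 * m powr (m / 8)"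
      using card_small_states[OF s(1)] unfolding B_def by (simp add: powr_add four)
    \<comment> \<open>\<open>space_bound\<close> with \<open>q = n ^ 2\<close> and
      \<open>b = ?u * \<beta>\<close>; states with fewer than \<open>?s'\<close> bits lie in
      \<open>B\<close> because \<open>?s' \<le> s\<close>.\<close>
    have "\<exists>\<A>. game_prob \<A> (needs_space A U n \<epsilon> ?s') \<ge> 1 - \<epsilon> -
      (ln (real (n ^ 2)) / k + (real n ^ 2 + real (n ^ 2) * real n) / ?u
      + card B * (?u * \<beta> / ?u) ^ n + real (card B) ^ k * (1 - ?u * \<beta> / ?u) ^ n ^ 2)"
    proof (rule space_bound[OF A U(1)])
      show "finite B"
        unfolding B_def by (rule finite_small_states)
      show "st \<in> B" if "real (length (fst st) + length (snd st)) < ?s'" for st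
        unfolding B_def mem_Collect_eq using that s(2) by (rule less_le_trans)
    qed (use \<beta> u k in \<open>auto simp: mult_left_le\<close>)
    moreover have "ln (real (n ^ 2)) / k \<le> 2 * ln m / m powr (1/4)"
    proof -
      have "ln (real (n ^ 2)) = 2 * ln m"
        using m by (simp add: m_def ln_realpow)
      then show ?thesis
        using m k root by (simp add: frac_le)
    qed
    \<comment> \<open>The collision term is at most \<open>2 * n ^ 3 / ?u\<close>, and the universe
      has more than \<open>n ^ 4\<close> elements.\<close>
    moreover have "(real n ^ 2 + real (n ^ 2) * real n) / ?u \<le> 2 / m"
    proof -
      have "m ^ 2 * 1 \<le> m ^ 2 * m"
        using m by (intro mult_left_mono) auto
      then have "(m ^ 2 + m ^ 2 * m) * m \<le> (2 * (m ^ 2 * m)) * m"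
        using m by (intro mult_right_mono) auto
      also have "\<dots> = 2 * m ^ 4"
        by (simp add: power_numeral_reduce)
      also have "m ^ 4 \<le> ?u"
        using U(2) by (simp add: m_def flip: of_nat_power)
      finally show ?thesis
        using m u by (simp add: m_def field_simps)
    qed
    moreover have "card B * (?u * \<beta> / ?u) ^ n \<le> 4 * m powr (- m / 8)"
    proof -
      have "\<beta> ^ n = m powr (- m / 4)"
        using m by (simp add: \<beta>_def m_def powr_power)
      then have "card B * \<beta> ^ n \<le> 4 * m powr (m / 8) * m powr (- m / 4)"
        using B by (simp add: mult_right_mono)
      also have "\<dots> = 4 * m powr (- m / 8)"
        by (simp flip: powr_add)
      finally show ?thesis using u by simp
    qed
    moreover have "real (card B) ^ k * (1 - ?u * \<beta> / ?u) ^ n ^ 2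
        \<le> exp ((m powr (1/4) + 1) * (ln 4 + m / 8 * ln m) - m powr (7/4))"
    proof -
      have "real (card B) ^ k \<le> exp (ln 4 + m / 8 * ln m) ^ k"
        using B m by (intro power_mono) (auto simp: exp_add powr_def)
      also have "\<dots> = exp (k * (ln 4 + m / 8 * ln m))"
        by (rule exp_of_nat_mult[symmetric])
      also have "\<dots> \<le> exp ((m powr (1/4) + 1) * (ln 4 + m / 8 * ln m))"
        using k m by (auto intro!: mult_right_mono add_nonneg_nonneg)
      finally have 1: "real (card B) ^ k \<le> exp ((m powr (1/4) + 1) * (ln 4 + m / 8 * ln m))" .
      \<comment> \<open>\<open>1 - \<beta> \<le> exp (- \<beta>)\<close>, and
        \<open>n ^ 2 * \<beta>\<close> is \<open>m powr (7/4)\<close>.\<close>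
      have "(1 - \<beta>) ^ n ^ 2 \<le> exp (- \<beta>) ^ n ^ 2"
        using \<beta> exp_ge_add_one_self[of "- \<beta>"] by (intro power_mono) auto
      also have "\<dots> = exp (real (n ^ 2) * (- \<beta>))"
        by (rule exp_of_nat_mult[symmetric])
      also have "real (n ^ 2) * (- \<beta>) = - (m powr 2 * m powr (- (1/4)))"
        using m by (simp add: \<beta>_def m_def)
      also have "\<dots> = - (m powr (7/4))"
        by (simp flip: powr_add)
      finally have 2: "(1 - \<beta>) ^ n ^ 2 \<le> exp (- (m powr (7/4)))" .
      have "real (card B) ^ k * (1 - \<beta>) ^ n ^ 2
          \<le> exp ((m powr (1/4) + 1) * (ln 4 + m / 8 * ln m)) * exp (- (m powr (7/4)))"
        using \<beta> by (intro mult_mono 1 2) auto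
      also have "\<dots> = exp ((m powr (1/4) + 1) * (ln 4 + m / 8 * ln m) - m powr (7/4))"
        by (simp flip: exp_add)
      finally show ?thesis
        using u by simp
    qed
    \<comment> \<open>The four estimates add up to the left side of the inequality in
      \<open>N0\<close>.\<close>
    ultimately show ?thesis
      using N0[of n] n unfolding m_def by (elim exE) (rule exI, erule order_trans[rotated], linarith)
  qed
  show ?thesis
    by (rule exI[of _ "1/16"], rule conjI, simp, rule exI[of _ "1/8"], rule conjI, simp,
        rule exI[of _ "max N0 2"]) (use main in blast)
qed

end
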